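(* Let $p$ be a prime. Let $G\cong\mathbb{Z}_p^{r_1}\oplus\mathbb{Z}_{p^2}^{r_2}\oplus\cdots\oplus\mathbb{Z}_{p^e}^{r_e}$ with $e\geq1$, $r_i\geq0$ for $1\leq i\leq e-1$, $r_e\geq1$. Let $\Gamma$ be the group with signature given by the $p$-datum $(x_1,\dots,x_f;h)$, where $h\geq 0$, $f\geq 0$, and $x_f>0$ if $f\geq 1$, and let $H=\Gamma/[\Gamma,\Gamma]$. If there exists a smooth epimorphism $\varphi:H\to G$, then $f'=f\leq e$, and $$2h+\sum_{j=i}^f x_j\geq 1+\sum_{j=i}^e r_j\quad\text{for }1\leq i\leq f,\qquad\text{and}\qquad 2h\geq\sum_{j=f+1}^e r_j.$$ Moreover, if $p=2$ and $e'<f$, then $x_f$ is even.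
   Context: The group $\Gamma$ with $p$-datum $(x_1,\dots,x_f;h)$ ($x_i\in\mathbb{N}_0$; for $f=0$ the datum is $(-;h)$) is generated by $a_k,b_k$ ($1\leq k\leq h$) and $c_{ij}$ ($1\leq i\leq f$, $1\leq j\leq x_i$), subject to $c_{ij}^{p^i}=1$ and $\prod_{k=1}^h[a_k,b_k]\cdot\prod_{i=1}^f\prod_{j=1}^{x_i}c_{ij}=1$. Elements of $\Gamma$ are identified with their images in $H=\Gamma/[\Gamma,\Gamma]$. An epimorphism $\varphi:H\to G$ is called smooth if $\varphi(c_{ij})$ has order $p^i$ for all $1\leq i\leq f$, $1\leq j\leq x_i$, and (if $f\geq1$) $\prod_{j=1}^{x_f-1}\varphi(c_{fj})$ has order $p^f$. $f'$: put $f'=0$ if $\sum_{i=1}^f x_i\leq1$, and $f'=\max\{1\leq d\leq f:\sum_{i=d}^f x_i\geq2\}$ otherwise. $e'$: put $e'=0$ if $\sum_{i=1}^e r_i\leq1$, and $e'=\max\{1\leq d\leq e:\sum_{i=d}^e r_i\geq2\}$ otherwise. *)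

theory Defs
  imports "HOL-Algebra.Algebra" "HOL-Computational_Algebra.Primes"
begin

section \<open>Groups given by generators and relators\<close>

text \<open>
  A word over \<open>S\<close> is a list of letters \<open>(s, b)\<close> with \<open>s \<in> S\<close>; the letter \<open>(s, True)\<close> stands
  for \<open>s\<close> and \<open>(s, False)\<close> for its formal inverse. The relation \<open>word_eq S R\<close> is the least
  congruence on words over \<open>S\<close> that cancels adjacent inverse letters and kills the words in \<open>R\<close>,
  so its classes form the quotient of the free group on \<open>S\<close> by the normal closure of \<open>R\<close>.
\<close>

type_synonym 'a word = "('a \<times> bool) list"

definition words :: "'a set \<Rightarrow> 'a word set" where
  "words S = lists (S \<times> UNIV)"

inductive word_eq :: "'a set \<Rightarrow> 'a word set \<Rightarrow> 'a word \<Rightarrow> 'a word \<Rightarrow> bool"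
  for S :: "'a set" and R :: "'a word set" where
  refl: "u \<in> words S \<Longrightarrow> word_eq S R u u"
| sym: "word_eq S R u v \<Longrightarrow> word_eq S R v u"
| trans: "word_eq S R u v \<Longrightarrow> word_eq S R v w \<Longrightarrow> word_eq S R u w"
| append: "word_eq S R u u' \<Longrightarrow> word_eq S R v v' \<Longrightarrow> word_eq S R (u @ v) (u' @ v')"
| cancel: "s \<in> S \<Longrightarrow> word_eq S R [(s, b), (s, \<not> b)] []"
| relator: "w \<in> R \<Longrightarrow> w \<in> words S \<Longrightarrow> word_eq S R w []"

definition word_class :: "'a set \<Rightarrow> 'a word set \<Rightarrow> 'a word \<Rightarrow> 'a word set" where
  "word_class S R w = {v. word_eq S R w v}"

definition presented_group :: "'a set \<Rightarrow> 'a word set \<Rightarrow> 'a word set monoid" where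
  "presented_group S R =
     \<lparr>carrier = word_class S R ` words S,
      monoid.mult = (\<lambda>U V. \<Union>u\<in>U. \<Union>v\<in>V. word_class S R (u @ v)),
      one = word_class S R []\<rparr>"

lemma words_append [simp]: "u @ v \<in> words S \<longleftrightarrow> u \<in> words S \<and> v \<in> words S"
  by (auto simp: words_def)

lemma words_Nil [simp]: "[] \<in> words S"
  by (simp add: words_def)

lemma words_Cons [simp]: "x # w \<in> words S \<longleftrightarrow> fst x \<in> S \<and> w \<in> words S"
  by (cases x) (auto simp: words_def)

lemma word_eq_words: "word_eq S R u v \<Longrightarrow> u \<in> words S \<and> v \<in> words S"
  by (induction rule: word_eq.induct) auto

lemma word_class_eq_iff:
  "u \<in> words S \<Longrightarrow> word_class S R u = word_class S R v \<longleftrightarrow> word_eq S R u v"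
proof
  assume u: "u \<in> words S" and "word_class S R u = word_class S R v"
  then have "u \<in> word_class S R v"
    using word_eq.refl[OF u, of R] by (simp add: word_class_def set_eq_iff)
  then show "word_eq S R u v" by (simp add: word_class_def word_eq.sym)
next
  assume eq: "word_eq S R u v"
  have "word_eq S R u w \<longleftrightarrow> word_eq S R v w" for w
    using word_eq.trans[OF eq, of w] word_eq.trans[OF word_eq.sym[OF eq], of w] by metis
  then show "word_class S R u = word_class S R v" by (simp add: word_class_def)
qed

lemma carrier_presented_group: "carrier (presented_group S R) = word_class S R ` words S"
  by (simp add: presented_group_def)

lemma presented_group_mult:
  assumes "u \<in> words S" "v \<in> words S"
  shows "word_class S R u \<otimes>\<^bsub>presented_group S R\<^esub> word_class S R v = word_class S R (u @ v)"
proof -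
  have uv: "u @ v \<in> words S" using assms by simp
  have *: "word_class S R (u' @ v') = word_class S R (u @ v)"
    if u': "u' \<in> word_class S R u" and v': "v' \<in> word_class S R v" for u' v'
  proof -
    have "word_eq S R u u'" "word_eq S R v v'"
      using u' v' by (simp_all add: word_class_def)
    then have "word_eq S R (u @ v) (u' @ v')" by (rule word_eq.append)
    then show ?thesis by (simp only: word_class_eq_iff[OF uv, symmetric])
  qed
  have ne: "u \<in> word_class S R u" "v \<in> word_class S R v"
    using assms by (simp_all add: word_class_def word_eq.refl)
  have "word_class S R u \<otimes>\<^bsub>presented_group S R\<^esub> word_class S R v =
      (\<Union>u'\<in>word_class S R u. \<Union>v'\<in>word_class S R v. word_class S R (u' @ v'))"
    by (simp add: presented_group_def)
  also have "\<dots> = (\<Union>u'\<in>word_class S R u. \<Union>v'\<in>word_class S R v. word_class S R (u @ v))"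
    by (intro SUP_cong HOL.refl *)
  also have "\<dots> = word_class S R (u @ v)" using ne by blast
  finally show ?thesis .
qed

definition inverse_word :: "'a word \<Rightarrow> 'a word" where
  "inverse_word w = rev (map (\<lambda>(s, b). (s, \<not> b)) w)"

lemma inverse_word_words: "w \<in> words S \<Longrightarrow> inverse_word w \<in> words S"
  by (induction w) (auto simp: inverse_word_def split: prod.splits)

lemma inverse_word_cancel: "w \<in> words S \<Longrightarrow> word_eq S R (inverse_word w @ w) []"
proof (induction w)
  case Nil
  then show ?case by (auto simp: inverse_word_def intro: word_eq.refl)
next
  case (Cons x w)
  obtain s b where x: "x = (s, b)" by (cases x)
  have sw: "s \<in> S" "w \<in> words S" using Cons.prems x by auto
  have "word_eq S R [(s, \<not> b), (s, b)] []"
    using word_eq.cancel[OF sw(1), of R "\<not> b"] by simp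
  from word_eq.append[OF word_eq.refl[OF inverse_word_words[OF sw(2)]]
        word_eq.append[OF this word_eq.refl[OF sw(2)]]]
  have "word_eq S R (inverse_word (x # w) @ x # w) (inverse_word w @ w)"
    by (simp add: inverse_word_def x)
  from word_eq.trans[OF this Cons.IH[OF sw(2)]] show ?case .
qed

lemma group_presented_group: "group (presented_group S R)"
proof (rule groupI)
  fix U V assume "U \<in> carrier (presented_group S R)" "V \<in> carrier (presented_group S R)"
  then show "U \<otimes>\<^bsub>presented_group S R\<^esub> V \<in> carrier (presented_group S R)"
    by (auto simp: carrier_presented_group presented_group_mult)
next
  show "\<one>\<^bsub>presented_group S R\<^esub> \<in> carrier (presented_group S R)"
    by (auto simp: presented_group_def)
next
  fix U V W
  assume "U \<in> carrier (presented_group S R)" "V \<in> carrier (presented_group S R)"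
    "W \<in> carrier (presented_group S R)"
  then obtain u v w where "u \<in> words S" "v \<in> words S" "w \<in> words S"
    "U = word_class S R u" "V = word_class S R v" "W = word_class S R w"
    by (auto simp: presented_group_def)
  then show "U \<otimes>\<^bsub>presented_group S R\<^esub> V \<otimes>\<^bsub>presented_group S R\<^esub> W =
      U \<otimes>\<^bsub>presented_group S R\<^esub> (V \<otimes>\<^bsub>presented_group S R\<^esub> W)"
    by (simp add: presented_group_mult)
next
  fix U assume "U \<in> carrier (presented_group S R)"
  then obtain u where u: "u \<in> words S" "U = word_class S R u"
    by (auto simp: presented_group_def)
  have one: "\<one>\<^bsub>presented_group S R\<^esub> = word_class S R []"
    by (simp add: presented_group_def)
  show "\<one>\<^bsub>presented_group S R\<^esub> \<otimes>\<^bsub>presented_group S R\<^esub> U = U"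
    by (simp add: one u presented_group_mult)
  have "word_class S R (inverse_word u) \<otimes>\<^bsub>presented_group S R\<^esub> U = \<one>\<^bsub>presented_group S R\<^esub>"
    using u by (simp add: one presented_group_mult inverse_word_words word_class_eq_iff
        inverse_word_cancel)
  moreover have "word_class S R (inverse_word u) \<in> carrier (presented_group S R)"
    using u by (simp add: presented_group_def inverse_word_words)
  ultimately show "\<exists>V\<in>carrier (presented_group S R).
      V \<otimes>\<^bsub>presented_group S R\<^esub> U = \<one>\<^bsub>presented_group S R\<^esub>"
    by blast
qed

section \<open>The group of a datum, and smooth epimorphisms\<close>

text \<open>
  A datum \<open>(x\<^sub>1, \<dots>, x\<^sub>f; h)\<close> is given by \<open>f\<close>, a function \<open>x\<close> of which only the values
  at \<open>1, \<dots>, f\<close> matter, and \<open>h\<close>.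
\<close>

datatype gen = GenA nat | GenB nat | GenC nat nat

definition gens :: "nat \<Rightarrow> (nat \<Rightarrow> nat) \<Rightarrow> nat \<Rightarrow> gen set" where
  "gens f x h = GenA ` {1..h} \<union> GenB ` {1..h} \<union> {GenC i j | i j. i \<in> {1..f} \<and> j \<in> {1..x i}}"

definition commutator_word :: "'a \<Rightarrow> 'a \<Rightarrow> 'a word" where
  "commutator_word a b = [(a, True), (b, True), (a, False), (b, False)]"

definition long_relator :: "nat \<Rightarrow> (nat \<Rightarrow> nat) \<Rightarrow> nat \<Rightarrow> gen word" where
  "long_relator f x h =
     concat (map (\<lambda>k. commutator_word (GenA k) (GenB k)) [1..<Suc h]) @
     concat (map (\<lambda>i. map (\<lambda>j. (GenC i j, True)) [1..<Suc (x i)]) [1..<Suc f])"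

definition relators :: "nat \<Rightarrow> nat \<Rightarrow> (nat \<Rightarrow> nat) \<Rightarrow> nat \<Rightarrow> gen word set" where
  "relators p f x h =
     {replicate (p ^ i) (GenC i j, True) | i j. i \<in> {1..f} \<and> j \<in> {1..x i}}
     \<union> {long_relator f x h}"

definition datum_group :: "nat \<Rightarrow> nat \<Rightarrow> (nat \<Rightarrow> nat) \<Rightarrow> nat \<Rightarrow> gen word set monoid" where
  "datum_group p f x h = presented_group (gens f x h) (relators p f x h)"

definition abelianization :: "('a, 'b) monoid_scheme \<Rightarrow> 'a set monoid" where
  "abelianization G = G Mod derived G (carrier G)"

text \<open>The image in \<open>H = \<Gamma>/[\<Gamma>,\<Gamma>]\<close> of a generator of \<open>\<Gamma>\<close>.\<close>

definition datum_gen :: "nat \<Rightarrow> nat \<Rightarrow> (nat \<Rightarrow> nat) \<Rightarrow> nat \<Rightarrow> gen \<Rightarrow> gen word set set" where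
  "datum_gen p f x h s =
     derived (datum_group p f x h) (carrier (datum_group p f x h)) #>\<^bsub>datum_group p f x h\<^esub>
       word_class (gens f x h) (relators p f x h) [(s, True)]"

lemma long_relator_words: "long_relator f x h \<in> words (gens f x h)"
  unfolding words_def by (auto simp: long_relator_def commutator_word_def gens_def)

lemma relators_words: "relators p f x h \<subseteq> words (gens f x h)"
  using long_relator_words[of f x h]
  by (auto simp: relators_def words_def gens_def)

lemma datum_gen_closed:
  "s \<in> gens f x h \<Longrightarrow> datum_gen p f x h s \<in> carrier (abelianization (datum_group p f x h))"
  by (auto simp: datum_gen_def abelianization_def FactGroup_def RCOSETS_def datum_group_def
      presented_group_def)

lemma comm_group_abelianization:
  assumes "group G"
  shows "comm_group (abelianization G)"
  unfolding abelianization_def by (rule group.derived_quot_is_comm_group[OF assms])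

definition smooth_epimorphism ::
  "nat \<Rightarrow> nat \<Rightarrow> (nat \<Rightarrow> nat) \<Rightarrow> nat \<Rightarrow> ('g, 'm) monoid_scheme \<Rightarrow> (gen word set set \<Rightarrow> 'g) \<Rightarrow> bool"
  where
  "smooth_epimorphism p f x h G \<phi> \<longleftrightarrow>
     \<phi> \<in> epi (abelianization (datum_group p f x h)) G \<and>
     (\<forall>i\<in>{1..f}. \<forall>j\<in>{1..x i}. group.ord G (\<phi> (datum_gen p f x h (GenC i j))) = p ^ i) \<and>
     (f \<ge> 1 \<longrightarrow>
        group.ord G (finprod G (\<lambda>j. \<phi> (datum_gen p f x h (GenC f j))) {1..x f - 1}) = p ^ f)"

section \<open>Abelian p-groups and the indices f' and e'\<close>

definition abelian_p_group :: "nat \<Rightarrow> nat \<Rightarrow> (nat \<Rightarrow> nat) \<Rightarrow> (nat \<times> nat \<Rightarrow> int) monoid" where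
  "abelian_p_group p e r =
     sum_group (SIGMA i:{1..e}. {1..r i}) (\<lambda>(i, j). integer_mod_group (p ^ i))"

text \<open>The index \<open>f'\<close> is \<open>primed_index f x\<close>, and \<open>e'\<close> is \<open>primed_index e r\<close>.\<close>

definition primed_index :: "nat \<Rightarrow> (nat \<Rightarrow> nat) \<Rightarrow> nat" where
  "primed_index n y =
     (if (\<Sum>i=1..n. y i) \<le> 1 then 0 else Max {d \<in> {1..n}. (\<Sum>i=d..n. y i) \<ge> 2})"

end

(*
  Reducing the coordinates of G mod p, the coordinates belonging to the cyclic summands of order
  at least p^i form a surjection onto an F_p-vector space of dimension r_i + ... + r_e. Generators
  c_kj with k < i have order p^k, so these coordinates vanish mod p on them; the long relator makes
  one of the remaining c_fj redundant when i <= f. What is left is a spanning set, and the rank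
  inequalities follow by comparing cardinalities.

  If p = 2 and e' < f, then Z_{2^e} is the only summand of order at least 2^f. An element of order
  2^f has coordinate there equal to 2^(e-f) times an odd number, whereas c_ij with i < f contributes
  2^(e-f) times an even number; the long relator says that the sum is 0 mod 2^e, which makes the
  number x_f of odd contributions even.
*)

theory Submission
  imports Defs "HOL-Number_Theory.Cong"
begin

section \<open>Spanning sets modulo \<open>p\<close>, compared by counting\<close>

text \<open>Coefficients matter only modulo \<open>p\<close>, so the \<open>p ^ card S\<close>
  reduced coefficient vectors map onto the \<open>p ^ card T\<close> reduced value vectors.\<close>

lemma card_le_if_spanning_mod:
  fixes a :: "'s \<Rightarrow> 't \<Rightarrow> int" and p :: nat
  assumes p: "p \<ge> 2" and "finite S" "finite T"
    and span: "\<And>v. \<exists>n. \<forall>t\<in>T. [v t = (\<Sum>s\<in>S. n s * a s t)] (mod int p)"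
  shows "card T \<le> card S"
proof -
  let ?B = "{0..<int p}"
  define F where "F n = (\<lambda>t\<in>T. (\<Sum>s\<in>S. n s * a s t) mod int p)" for n :: "'s \<Rightarrow> int"
  have "T \<rightarrow>\<^sub>E ?B \<subseteq> F ` (S \<rightarrow>\<^sub>E ?B)"
  proof
    fix v assume v: "v \<in> T \<rightarrow>\<^sub>E ?B"
    obtain n where n: "\<forall>t\<in>T. [v t = (\<Sum>s\<in>S. n s * a s t)] (mod int p)"
      using span by blast
    define n' where "n' = (\<lambda>s\<in>S. n s mod int p)"
    have "F n' t = v t" for t
    proof (cases "t \<in> T")
      case True
      have "[(\<Sum>s\<in>S. n' s * a s t) = (\<Sum>s\<in>S. n s * a s t)] (mod int p)"
        by (intro cong_sum cong_mult) (auto simp: n'_def cong_def)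
      then have "[v t = (\<Sum>s\<in>S. n' s * a s t)] (mod int p)"
        using n True cong_trans cong_sym by blast
      moreover have "v t mod int p = v t"
        using v True by (auto simp: PiE_iff)
      ultimately show ?thesis using True by (simp add: F_def cong_def)
    next
      \<comment> \<open>Outside \<open>T\<close> both functions take the default value
        \<open>undefined\<close> of extensional functions.\<close>
      case False
      then show ?thesis using v by (auto simp: F_def PiE_iff extensional_def)
    qed
    moreover have "n' \<in> S \<rightarrow>\<^sub>E ?B" using p by (auto simp: n'_def)
    ultimately show "v \<in> F ` (S \<rightarrow>\<^sub>E ?B)" by (metis ext image_eqI)
  qed
  then have "card (T \<rightarrow>\<^sub>E ?B) \<le> card (S \<rightarrow>\<^sub>E ?B)"
    using assms by (intro surj_card_le finite_PiE) auto
  then have "p ^ card T \<le> p ^ card S"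
    using assms by (simp add: card_PiE)
  then show ?thesis using p by simp
qed

text \<open>Substituting for the redundant generators shows that \<open>S'\<close> alone still
  spans, so the count applies to \<open>S'\<close>.\<close>

lemma card_le_if_spanning_mod_reduced:
  fixes a :: "'s \<Rightarrow> 't \<Rightarrow> int" and p :: nat
  assumes p: "p \<ge> 2" and S: "finite S" "S' \<subseteq> S" and T: "finite T"
    and span: "\<And>v. \<exists>n. \<forall>t\<in>T. [v t = (\<Sum>s\<in>S. n s * a s t)] (mod int p)"
    and redundant: "\<And>s. s \<in> S - S' \<Longrightarrow>
      \<exists>k. \<forall>t\<in>T. [a s t = (\<Sum>s'\<in>S'. k s' * a s' t)] (mod int p)"
  shows "card T \<le> card S'"
proof (rule card_le_if_spanning_mod[OF p _ T])
  show "finite S'" using S by (rule finite_subset[rotated])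
  fix v
  obtain K where K: "\<And>s t. s \<in> S - S' \<Longrightarrow> t \<in> T \<Longrightarrow>
      [a s t = (\<Sum>s'\<in>S'. K s s' * a s' t)] (mod int p)"
    using redundant by metis
  obtain n where n: "\<forall>t\<in>T. [v t = (\<Sum>s\<in>S. n s * a s t)] (mod int p)"
    using span by blast
  \<comment> \<open>Replacing each discarded \<open>s\<close> by its combination adds
    \<open>n s * K s s'\<close> to the coefficient of \<open>s'\<close>.\<close>
  define n' where "n' s' = n s' + (\<Sum>s\<in>S - S'. n s * K s s')" for s'
  have "[v t = (\<Sum>s\<in>S'. n' s * a s t)] (mod int p)" if t: "t \<in> T" for t
  proof -
    have "(\<Sum>s\<in>S. n s * a s t) = (\<Sum>s\<in>S'. n s * a s t) + (\<Sum>s\<in>S - S'. n s * a s t)"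
      using sum.subset_diff[OF S(2,1)] by (simp add: add.commute)
    moreover have "[\<dots> = (\<Sum>s\<in>S'. n s * a s t) +
        (\<Sum>s\<in>S - S'. n s * (\<Sum>s'\<in>S'. K s s' * a s' t))] (mod int p)"
      by (intro cong_add cong_refl cong_sum cong_mult K t)
    moreover have "(\<Sum>s\<in>S - S'. n s * (\<Sum>s'\<in>S'. K s s' * a s' t)) =
        (\<Sum>s'\<in>S'. (\<Sum>s\<in>S - S'. n s * K s s') * a s' t)"
      by (simp add: sum_distrib_left sum_distrib_right mult.assoc) (rule sum.swap)
    ultimately have "[(\<Sum>s\<in>S. n s * a s t) = (\<Sum>s\<in>S'. n' s * a s t)] (mod int p)"
      by (simp add: n'_def distrib_right sum.distrib)
    then show ?thesis using n t cong_trans by blast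
  qed
  then show "\<exists>n. \<forall>t\<in>T. [v t = (\<Sum>s\<in>S'. n s * a s t)] (mod int p)" by blast
qed

section \<open>Coordinates on a product of cyclic groups\<close>

text \<open>
  The integer \<open>\<chi> t a\<close> is only meaningful modulo \<open>m t\<close>: this is an isomorphism of \<open>G\<close> with the
  product of the groups \<open>\<int>/m t\<close>, spelled out with congruences.
\<close>

locale cyclic_coordinates = group G for G :: "('g, 'm) monoid_scheme" (structure) +
  fixes T :: "'t set" and m :: "'t \<Rightarrow> nat" and \<chi> :: "'t \<Rightarrow> 'g \<Rightarrow> int"
  assumes coord_mult: "\<lbrakk>t \<in> T; a \<in> carrier G; b \<in> carrier G\<rbrakk> \<Longrightarrow>
      [\<chi> t (a \<otimes> b) = \<chi> t a + \<chi> t b] (mod int (m t))"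
    and eq_one_if_coord: "\<lbrakk>a \<in> carrier G; \<And>t. t \<in> T \<Longrightarrow> [\<chi> t a = 0] (mod int (m t))\<rbrakk> \<Longrightarrow> a = \<one>"
    and coord_surj: "\<exists>a\<in>carrier G. \<forall>t\<in>T. [\<chi> t a = v t] (mod int (m t))"
begin

lemma coord_one: "t \<in> T \<Longrightarrow> [\<chi> t \<one> = 0] (mod int (m t))"
  using coord_mult[of t \<one> \<one>] by (simp add: cong_iff_dvd_diff)

lemma eq_one_iff_coord:
  "a \<in> carrier G \<Longrightarrow> a = \<one> \<longleftrightarrow> (\<forall>t\<in>T. [\<chi> t a = 0] (mod int (m t)))"
  using eq_one_if_coord coord_one by blast

lemma coord_pow:
  assumes "t \<in> T" "a \<in> carrier G"
  shows "[\<chi> t (a [^] n) = int n * \<chi> t a] (mod int (m t))"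
proof (induction n)
  case 0
  then show ?case using coord_one assms by simp
next
  case (Suc n)
  have "[\<chi> t (a [^] n \<otimes> a) = \<chi> t (a [^] n) + \<chi> t a] (mod int (m t))"
    using assms by (intro coord_mult) auto
  moreover have "[\<chi> t (a [^] n) + \<chi> t a = int n * \<chi> t a + \<chi> t a] (mod int (m t))"
    using Suc by (intro cong_add cong_refl)
  ultimately show ?case
    using cong_trans by (fastforce simp: algebra_simps)
qed

text \<open>A power is trivial exactly when all its coordinates vanish, so conditions on orders,
  smoothness among them, become divisibilities between integers.\<close>

lemma ord_dvd_iff_coord:
  assumes "a \<in> carrier G"
  shows "ord a dvd n \<longleftrightarrow> (\<forall>t\<in>T. int (m t) dvd int n * \<chi> t a)"
proof -
  have "ord a dvd n \<longleftrightarrow> (\<forall>t\<in>T. [\<chi> t (a [^] n) = 0] (mod int (m t)))"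
    using assms by (simp add: eq_one_iff_coord flip: pow_eq_id)
  also have "\<dots> \<longleftrightarrow> (\<forall>t\<in>T. [int n * \<chi> t a = 0] (mod int (m t)))"
    using coord_pow[OF _ assms] by (meson cong_sym cong_trans)
  finally show ?thesis by (simp add: cong_0_iff)
qed

text \<open>Concatenation becomes addition of coordinates, and cancellation of a letter with its
  inverse forces the sign -1; hence only the signed letters of a word matter, not their
  order.\<close>

lemma coord_hom_word:
  assumes \<psi>: "\<psi> \<in> hom (presented_group S R) G" and t: "t \<in> T" and "w \<in> words S"
  shows "[\<chi> t (\<psi> (word_class S R w)) =
    (\<Sum>(s, b)\<leftarrow>w. (if b then 1 else - 1) * \<chi> t (\<psi> (word_class S R [(s, True)])))]
    (mod int (m t))"
  using assms(3)
proof (induction w)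
  case Nil
  have "\<psi> (word_class S R []) = \<one>"
    using hom_one[OF \<psi> group_presented_group is_group] by (simp add: presented_group_def)
  then show ?case using coord_one[OF t] by simp
next
  case (Cons l w)
  obtain s b where l: "l = (s, b)" by (cases l)
  have s: "s \<in> S" and w: "w \<in> words S" using Cons.prems l by auto
  have class_in: "word_class S R u \<in> carrier (presented_group S R)" if "u \<in> words S" for u
    using that by (simp add: carrier_presented_group)
  have append: "[\<chi> t (\<psi> (word_class S R (u @ v))) =
      \<chi> t (\<psi> (word_class S R u)) + \<chi> t (\<psi> (word_class S R v))] (mod int (m t))"
    if "u \<in> words S" "v \<in> words S" for u v
    using coord_mult[OF t hom_in_carrier[OF \<psi> class_in[OF that(1)]] hom_in_carrier[OF \<psi> class_in[OF that(2)]]]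
      hom_mult[OF \<psi> class_in[OF that(1)] class_in[OF that(2)]] that
    by (simp add: presented_group_mult)
  have "[\<chi> t (\<psi> (word_class S R [(s, False)])) = - \<chi> t (\<psi> (word_class S R [(s, True)]))]
      (mod int (m t))"
  proof -
    have "word_class S R ([(s, True)] @ [(s, False)]) = word_class S R []"
      using word_eq.cancel[OF s, of R True] s by (simp add: word_class_eq_iff)
    moreover have "\<psi> (word_class S R []) = \<one>"
      using hom_one[OF \<psi> group_presented_group is_group] by (simp add: presented_group_def)
    ultimately have "[\<chi> t \<one> =
        \<chi> t (\<psi> (word_class S R [(s, True)])) + \<chi> t (\<psi> (word_class S R [(s, False)]))] (mod int (m t))"
      using append[of "[(s, True)]" "[(s, False)]"] s by simp
    then have "[\<chi> t (\<psi> (word_class S R [(s, True)])) + \<chi> t (\<psi> (word_class S R [(s, False)])) = 0]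
        (mod int (m t))"
      using coord_one[OF t] cong_sym cong_trans by blast
    then show ?thesis by (simp add: cong_iff_dvd_diff add.commute)
  qed
  then have letter: "[\<chi> t (\<psi> (word_class S R [l])) =
      (if b then 1 else - 1) * \<chi> t (\<psi> (word_class S R [(s, True)]))] (mod int (m t))"
    by (cases b) (simp_all add: l)
  have "[\<chi> t (\<psi> (word_class S R ([l] @ w))) =
      \<chi> t (\<psi> (word_class S R [l])) + \<chi> t (\<psi> (word_class S R w))] (mod int (m t))"
    using s w l by (intro append) auto
  from cong_trans[OF this cong_add[OF letter Cons.IH[OF w]]] show ?case
    by (simp add: l)
qed

end

text \<open>The coordinates are the components of the isomorphism; the second entry of an index only
  numbers summands of equal order.\<close>

lemma cyclic_coordinates_if_iso_abelian_p_group: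
  fixes G :: "('g, 'm) monoid_scheme"
  assumes p: "p > 0" and G: "group G" and "G \<cong> abelian_p_group p e r"
  obtains \<chi> where
    "cyclic_coordinates G (SIGMA i:{1..e}. {1..r i}) (\<lambda>t. p ^ fst t) \<chi>"
proof -
  let ?T = "SIGMA i:{1..e}. {1..r i}"
  let ?A = "abelian_p_group p e r"
  obtain \<theta> where \<theta>: "\<theta> \<in> iso G ?A" using assms(3) by (auto simp: is_iso_def)
  then have hom: "\<theta> \<in> hom G ?A" and bij: "bij_betw \<theta> (carrier G) (carrier ?A)"
    by (auto simp: iso_def)
  have A: "group ?A"
    unfolding abelian_p_group_def by (intro sum_group) (simp add: split_beta)
  \<comment> \<open>The index set is finite, so every family has finite support;
    \<open>p > 0\<close> excludes \<open>integer_mod_group 0\<close>, which is infinite.\<close>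
  have carrier: "carrier ?A = (\<Pi>\<^sub>E t\<in>?T. {0..<int (p ^ fst t)})"
    using p by (auto simp: abelian_p_group_def carrier_sum_group carrier_integer_mod_group
        split_beta intro: finite_subset[of _ ?T])
  have one: "\<one>\<^bsub>?A\<^esub> = (\<lambda>t\<in>?T. 0)"
    by (simp add: abelian_p_group_def split_beta)
  have mult: "(\<theta> (a \<otimes>\<^bsub>G\<^esub> b)) t = (\<theta> a t + \<theta> b t) mod int (p ^ fst t)"
    if "t \<in> ?T" "a \<in> carrier G" "b \<in> carrier G" for t a b
    using hom_mult[OF hom that(2,3)] that(1) by (simp add: abelian_p_group_def split_beta)
  have "cyclic_coordinates G ?T (\<lambda>t. p ^ fst t) (\<lambda>t a. \<theta> a t)"
  proof (intro cyclic_coordinates.intro G cyclic_coordinates_axioms.intro)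
    fix t a b assume "t \<in> ?T" "a \<in> carrier G" "b \<in> carrier G"
    from mult[OF this] show "[\<theta> (a \<otimes>\<^bsub>G\<^esub> b) t = \<theta> a t + \<theta> b t] (mod int (p ^ fst t))"
      by (simp add: cong_def)
  next
    fix a assume a: "a \<in> carrier G"
      and 0: "\<And>t. t \<in> ?T \<Longrightarrow> [\<theta> a t = 0] (mod int (p ^ fst t))"
    have in_A: "\<theta> a \<in> carrier ?A" using hom a by (rule hom_in_carrier)
    have "\<theta> a t = (\<lambda>t\<in>?T. 0) t" for t
    proof (cases "t \<in> ?T")
      case True
      then have "\<theta> a t \<in> {0..<int (p ^ fst t)}" using in_A carrier by blast
      then show ?thesis using 0[OF True] True by (simp add: cong_def)
    next
      case False
      then show ?thesis
        using PiE_arb[OF in_A[unfolded carrier]] by auto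
    qed
    then have "\<theta> a = \<theta> \<one>\<^bsub>G\<^esub>"
      using hom_one[OF hom G A] one by (metis ext)
    then show "a = \<one>\<^bsub>G\<^esub>"
      using bij a group.is_monoid[OF G] by (auto simp: bij_betw_def inj_on_def)
  next
    fix v :: "nat \<times> nat \<Rightarrow> int"
    have "(\<lambda>t\<in>?T. v t mod int (p ^ fst t)) \<in> \<theta> ` carrier G"
      using bij p by (simp add: bij_betw_def carrier)
    then obtain a where a: "(\<lambda>t\<in>?T. v t mod int (p ^ fst t)) = \<theta> a" "a \<in> carrier G"
      by (rule imageE)
    have "\<theta> a t = v t mod int (p ^ fst t)" if "t \<in> ?T" for t
      using fun_cong[OF a(1), of t] that by simp
    then show "\<exists>a\<in>carrier G. \<forall>t\<in>?T. [\<theta> a t = v t] (mod int (p ^ fst t))"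
      using a(2) by (intro bexI[of _ a] ballI) (simp_all add: cong_def)
  qed
  then show thesis by (rule that)
qed

section \<open>Exponent sums of words and passage to the presented group\<close>

text \<open>Collecting letters by generator, the coefficient of \<open>g s\<close> is the exponent
  sum of \<open>s\<close> in \<open>w\<close>.\<close>

lemma sum_word_eq_sum_generators:
  fixes g :: "'s \<Rightarrow> int"
  assumes "finite S" "w \<in> words S"
  shows "(\<Sum>(s, b)\<leftarrow>w. (if b then 1 else - 1) * g s) =
    (\<Sum>s\<in>S. (\<Sum>(s', b)\<leftarrow>w. if s' = s then (if b then 1 else - 1) else 0) * g s)"
  using assms(2)
proof (induction w)
  case (Cons l w)
  obtain s b where l: "l = (s, b)" by (cases l)
  have "(\<Sum>u\<in>S. (if s = u then (if b then 1 else - 1) else 0) * g u) = (if b then 1 else - 1) * g s"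
    using Cons.prems assms(1) l by (simp add: if_distrib[of "\<lambda>z. z * _"] cong: if_cong)
  then show ?case
    using Cons l by (simp add: distrib_right sum.distrib)
qed simp

text \<open>The bound \<open>i\<close> cuts off the \<open>c_kj\<close> with \<open>k < i\<close>:
  under a smooth epimorphism their coordinates vanish mod \<open>p\<close> in the summands of order
  at least \<open>p^i\<close>.\<close>

definition torsion_gens :: "nat \<Rightarrow> nat \<Rightarrow> (nat \<Rightarrow> nat) \<Rightarrow> gen set" where
  "torsion_gens i f x = (\<lambda>(k, j). GenC k j) ` (SIGMA k:{i..f}. {1..x k})"

lemma sum_torsion_gens:
  "(\<Sum>s\<in>torsion_gens i f x. g s) = (\<Sum>k=i..f. \<Sum>j=1..x k. g (GenC k j))"
  unfolding torsion_gens_def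
  by (subst sum.reindex) (auto simp: inj_on_def sum.Sigma split_beta)

lemma card_torsion_gens: "card (torsion_gens i f x) = (\<Sum>k=i..f. x k)"
  unfolding torsion_gens_def by (subst card_image) (auto simp: inj_on_def)

lemma finite_torsion_gens [simp]: "finite (torsion_gens i f x)"
  by (simp add: torsion_gens_def)

lemma gens_eq_torsion_gens:
  "gens f x h = GenA ` {1..h} \<union> GenB ` {1..h} \<union> torsion_gens 1 f x"
  by (auto simp: gens_def torsion_gens_def)

lemma finite_gens: "finite (gens f x h)"
  by (simp add: gens_eq_torsion_gens)

text \<open>Commutators have exponent sums 0, and every \<open>c_ij\<close> occurs once with
  exponent 1.\<close>

lemma sum_long_relator:
  fixes g :: "gen \<Rightarrow> int"
  shows "(\<Sum>(s, b)\<leftarrow>long_relator f x h. (if b then 1 else - 1) * g s) =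
    (\<Sum>s\<in>torsion_gens 1 f x. g s)"
proof -
  have concat: "sum_list (map \<gamma> (concat (map u ks))) = (\<Sum>k\<leftarrow>ks. sum_list (map \<gamma> (u k)))"
    for \<gamma> :: "gen \<times> bool \<Rightarrow> int" and u and ks :: "nat list"
    by (induction ks) auto
  have upt: "(\<Sum>k\<leftarrow>[1..<Suc n]. F k) = (\<Sum>k=1..n. F k)" for F :: "nat \<Rightarrow> int" and n
    by (simp only: interv_sum_list_conv_sum_set_nat set_upt atLeastLessThanSuc_atLeastAtMost)
  show ?thesis
    unfolding long_relator_def map_append sum_list_append concat sum_torsion_gens upt
    by (simp add: commutator_word_def comp_def upt[unfolded One_nat_def] del: upt_Suc)
qed

text \<open>A smooth epimorphism starts from the abelianization, while words and relators live in
  the presented group; composing with the quotient map connects the two.\<close>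

lemma epi_abelianization_lift:
  assumes K: "group K" and \<phi>: "\<phi> \<in> epi (abelianization K) G"
  shows "(\<lambda>a. \<phi> (derived K (carrier K) #>\<^bsub>K\<^esub> a)) \<in> epi K G"
proof -
  let ?q = "\<lambda>a. derived K (carrier K) #>\<^bsub>K\<^esub> a"
  have "?q \<in> hom K (abelianization K)"
    unfolding abelianization_def
    by (intro normal.r_coset_hom_Mod group.derived_self_is_normal K)
  moreover have "?q ` carrier K = carrier (abelianization K)"
    by (auto simp: abelianization_def FactGroup_def RCOSETS_def)
  ultimately show ?thesis
    using \<phi> hom_compose[of ?q K "abelianization K" \<phi> G] 
    by (auto simp: epi_def comp_def simp flip: image_image)
qed

section \<open>The indices f' and e'\<close>

text \<open>The tail sum from \<open>d = n\<close> is \<open>y n\<close> alone, so \<open>n\<close>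
  is a candidate for the maximum exactly when \<open>y n \<ge> 2\<close>.\<close>

lemma primed_index_eq_iff:
  assumes "n \<ge> 1"
  shows "primed_index n y = n \<longleftrightarrow> y n \<ge> 2"
proof -
  let ?D = "{d \<in> {1..n}. (\<Sum>i=d..n. y i) \<ge> 2}"
  show ?thesis
  proof
    assume n: "primed_index n y = n"
    \<comment> \<open>The default value 0 is excluded by \<open>n \<ge> 1\<close>, so the index is a
      genuine maximum.\<close>
    then have "(\<Sum>i=1..n. y i) \<ge> 2" 
      using assms by (auto simp: primed_index_def split: if_splits)
    then have "1 \<in> ?D" and Max: "Max ?D = n" using assms n by (auto simp: primed_index_def)
    then have "?D \<noteq> {}" by blast
    then have "Max ?D \<in> ?D" by (intro Max_in) simp_all
    then have "n \<in> ?D" by (simp only: Max)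
    then show "y n \<ge> 2" by simp
  next
    assume y: "y n \<ge> 2"
    then have "(\<Sum>i=1..n. y i) \<ge> 2"
      using assms member_le_sum[of n "{1..n}" y] by simp
    then have "primed_index n y = Max ?D" by (simp add: primed_index_def)
    also have "\<dots> = n" using assms y by (intro Max_eqI) auto
    finally show "primed_index n y = n" .
  qed
qed

text \<open>With a tail sum of at least 2, \<open>d\<close> would be a candidate and could not
  exceed the maximum. Applied to e' < f, this leaves at most one summand of order at least
  \<open>p^f\<close>.\<close>

lemma sum_le_1_if_primed_index_less:
  assumes "primed_index n y < d" "d \<le> n"
  shows "(\<Sum>i=d..n. y i) \<le> 1"
proof (rule ccontr)
  let ?D = "{d \<in> {1..n}. (\<Sum>i=d..n. y i) \<ge> 2}"
  assume gt: "\<not> ?thesis"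
  have "(\<Sum>i=d..n. y i) \<le> (\<Sum>i=1..n. y i)"
    using assms by (intro sum_mono2) auto
  then have "primed_index n y = Max ?D" using gt by (simp add: primed_index_def)
  moreover have "d \<in> ?D" using gt assms by auto
  ultimately have "d \<le> primed_index n y" by simp
  then show False using assms by simp
qed

section \<open>Numerical conditions forced by a smooth epimorphism\<close>

theorem mainTheorem2:
  fixes p e f h :: nat and r x :: "nat \<Rightarrow> nat" and G :: "('g, 'm) monoid_scheme"
  assumes "Factorial_Ring.prime p"
    and "e \<ge> 1" and "r e \<ge> 1"
    and "group G" and "G \<cong> abelian_p_group p e r"
    and "f \<ge> 1 \<Longrightarrow> x f > 0"
    and "\<exists>\<phi>. smooth_epimorphism p f x h G \<phi>"
  shows "primed_index f x = f \<and> f \<le> e \<and>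
    (\<forall>i\<in>{1..f}. 2 * h + (\<Sum>j=i..f. x j) \<ge> 1 + (\<Sum>j=i..e. r j)) \<and>
    2 * h \<ge> (\<Sum>j=f+1..e. r j) \<and>
    (p = 2 \<and> primed_index e r < f \<longrightarrow> even (x f))"
proof -
  have p: "p \<ge> 2" using assms(1) by (rule prime_ge_2_nat)
  let ?T = "SIGMA i:{1..e}. {1..r i}"
  obtain \<chi> where "cyclic_coordinates G ?T (\<lambda>t. p ^ fst t) \<chi>"
    using cyclic_coordinates_if_iso_abelian_p_group[OF _ assms(4,5)] p by auto
  then interpret cyclic_coordinates G ?T "\<lambda>t. p ^ fst t" \<chi> .
  obtain \<phi> where \<phi>: "smooth_epimorphism p f x h G \<phi>" using assms(7) by blast
  let ?S = "gens f x h" and ?R = "relators p f x h"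
  let ?K = "datum_group p f x h"
  define \<psi> where "\<psi> a = \<phi> (derived ?K (carrier ?K) #>\<^bsub>?K\<^esub> a)" for a
  define c where "c s = \<psi> (word_class ?S ?R [(s, True)])" for s
  have c_eq: "c s = \<phi> (datum_gen p f x h s)" for s
    by (simp add: c_def \<psi>_def datum_gen_def)
  have "\<psi> \<in> epi ?K G"
    unfolding \<psi>_def[abs_def] using \<phi>
    by (intro epi_abelianization_lift) (simp_all add: smooth_epimorphism_def datum_group_def group_presented_group)
  then have \<psi>: "\<psi> \<in> hom (presented_group ?S ?R) G"
    and surj: "\<psi> ` carrier (presented_group ?S ?R) = carrier G"
    by (simp_all add: epi_def datum_group_def)
  have c_closed: "c s \<in> carrier G" if "s \<in> ?S" for s
    using that hom_in_carrier[OF \<psi>] by (simp add: c_def carrier_presented_group)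
  note word = coord_hom_word[OF \<psi>, folded c_def]

  \<comment> \<open>Spanning, the long relation and orders in coordinates\<close>
  have span: "\<exists>n. \<forall>t\<in>?T. [v t = (\<Sum>s\<in>?S. n s * \<chi> t (c s))] (mod int (p ^ fst t))" for v
  proof -
    obtain a where a: "a \<in> carrier G" "\<forall>t\<in>?T. [\<chi> t a = v t] (mod int (p ^ fst t))"
      using coord_surj[of v] by blast
    then have "a \<in> \<psi> ` word_class ?S ?R ` words ?S"
      using surj by (simp add: carrier_presented_group)
    then obtain w where w: "w \<in> words ?S" "a = \<psi> (word_class ?S ?R w)" by blast
    \<comment> \<open>The exponent sums of a word mapping to \<open>a\<close> serve as coefficients
      for all \<open>t\<close> at once.\<close>
    define n where "n s = (\<Sum>(s', b)\<leftarrow>w. if s' = s then (if b then 1 else - 1) else 0 :: int)" for s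
    have "[v t = (\<Sum>s\<in>?S. n s * \<chi> t (c s))] (mod int (p ^ fst t))" if t: "t \<in> ?T" for t
      using word[OF t w(1)] a(2) t
      unfolding w(2) sum_word_eq_sum_generators[OF finite_gens w(1)] n_def
      by (meson cong_sym cong_trans)
    then show ?thesis by blast
  qed
  have relation: "[(\<Sum>s\<in>torsion_gens 1 f x. \<chi> t (c s)) = 0] (mod int (p ^ fst t))"
    if t: "t \<in> ?T" for t
  proof -
    have "word_eq ?S ?R (long_relator f x h) []"
      using long_relator_words by (intro word_eq.relator) (auto simp: relators_def)
    then have "word_class ?S ?R (long_relator f x h) = \<one>\<^bsub>presented_group ?S ?R\<^esub>"
      using word_class_eq_iff[OF long_relator_words] by (simp add: presented_group_def)
    then have "\<psi> (word_class ?S ?R (long_relator f x h)) = \<psi> \<one>\<^bsub>presented_group ?S ?R\<^esub>"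
      by simp
    also have "\<dots> = \<one>\<^bsub>G\<^esub>" by (rule hom_one[OF \<psi> group_presented_group is_group])
    finally show ?thesis
      using word[OF t long_relator_words] coord_one[OF t]
      by (simp add: sum_long_relator) (meson cong_sym cong_trans)
  qed
  have ord_c: "ord (c (GenC i j)) = p ^ i" if "i \<in> {1..f}" "j \<in> {1..x i}" for i j
    using \<phi> that by (simp add: smooth_epimorphism_def c_eq)
  have C_in: "GenC i j \<in> ?S" if "i \<in> {1..f}" "j \<in> {1..x i}" for i j
    using that by (auto simp: gens_def)
  \<comment> \<open>The slack \<open>i \<le> k\<close> allows one common exponent, \<open>f\<close>
    or \<open>f - 1\<close>, for generators of different orders in the parity argument.\<close>
  have annihilated: "int (p ^ fst t) dvd int (p ^ k) * \<chi> t (c (GenC i j))"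
    if "t \<in> ?T" "i \<in> {1..f}" "j \<in> {1..x i}" "i \<le> k" for t i j k
  proof -
    have "ord (c (GenC i j)) dvd p ^ k"
      using that by (simp add: ord_c le_imp_power_dvd)
    then show ?thesis
      using that ord_dvd_iff_coord[OF c_closed[OF C_in[OF that(2,3)]]] by blast
  qed
  have p_dvd: "int p dvd \<chi> t (c (GenC i j))"
    if t: "t \<in> ?T" and ij: "i \<in> {1..f}" "j \<in> {1..x i}" and "i < fst t" for t i j
  proof -
    \<comment> \<open>Since \<open>i + 1 \<le> fst t\<close>, one factor \<open>p\<close> is left
      after cancelling \<open>p^i\<close>.\<close>
    have "int p ^ i * int p dvd int (p ^ fst t)"
      using \<open>i < fst t\<close> le_imp_power_dvd[of "Suc i" "fst t" "int p"] by (simp add: mult.commute)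
    also have "\<dots> dvd int p ^ i * \<chi> t (c (GenC i j))"
      using annihilated[OF t ij] by simp
    finally show ?thesis using p by simp
  qed
  have span_p: "\<exists>n. \<forall>t\<in>T'. [v t = (\<Sum>s\<in>?S. n s * \<chi> t (c s))] (mod int p)"
    if "T' \<subseteq> ?T" for v T'
  proof -
    obtain n where n: "\<forall>t\<in>?T. [v t = (\<Sum>s\<in>?S. n s * \<chi> t (c s))] (mod int (p ^ fst t))"
      using span by blast
    have "[v t = (\<Sum>s\<in>?S. n s * \<chi> t (c s))] (mod int p)" if t: "t \<in> T'" for t
    proof (rule cong_dvd_modulus)
      show "[v t = (\<Sum>s\<in>?S. n s * \<chi> t (c s))] (mod int (p ^ fst t))"
        using n t \<open>T' \<subseteq> ?T\<close> by blast
      \<comment> \<open>Summand exponents start at 1, so each modulus is a multiple of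
        \<open>p\<close>.\<close>
      have "fst t > 0" using t \<open>T' \<subseteq> ?T\<close> by auto
      then show "int p dvd int (p ^ fst t)" by simp
    qed
    then show ?thesis by blast
  qed
  have dropped: "\<exists>k. \<forall>t\<in>T'. [\<chi> t (c s) = (\<Sum>s'\<in>S'. k s' * \<chi> t (c s'))] (mod int p)"
    if s_dropped: "s \<in> torsion_gens 1 f x - torsion_gens i f x"
      and T'_sub: "T' \<subseteq> {t \<in> ?T. i \<le> fst t}" for s i S' T'
  \<comment> \<open>All coefficients are 0: a generator with \<open>k < i\<close> vanishes mod
    \<open>p\<close> at every \<open>t\<close> in \<open>T'\<close>.\<close>
  proof (intro exI[of _ "\<lambda>_. 0"] ballI)
    fix t assume t: "t \<in> T'"
    obtain k j where s: "s = GenC k j" "k \<in> {1..f}" "j \<in> {1..x k}"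
      using s_dropped by (auto simp: torsion_gens_def)
    moreover have "k < i"
      using s_dropped s by (force simp: torsion_gens_def)
    ultimately have "int p dvd \<chi> t (c s)"
      using T'_sub t unfolding s(1) by (intro p_dvd) auto
    then show "[\<chi> t (c s) = (\<Sum>s'\<in>S'. 0 * \<chi> t (c s'))] (mod int p)"
      by (simp add: cong_0_iff)
  qed
  let ?AB = "GenA ` {1..h} \<union> GenB ` {1..h}"
  have card_AB: "card ?AB \<le> 2 * h"
    by (rule order_trans[OF card_Un_le]) (simp add: card_image inj_on_def)
  \<comment> \<open>These index the summands of order at least \<open>p^i\<close>; their number is
    the tail sum of \<open>r\<close> in the inequalities.\<close>
  define T' where "T' i = (SIGMA k:{i..e}. {1..r k})" for i
  have card_T': "card (T' i) = (\<Sum>k=i..e. r k)" for i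
    by (simp add: T'_def)
  have T'_sub: "T' i \<subseteq> {t \<in> ?T. i \<le> fst t}" if "i \<ge> 1" for i
    using that by (auto simp: T'_def)

  \<comment> \<open>For \<open>x f = 1\<close> the product in the smoothness condition is empty, hence of order 1.\<close>
  have f': "x f \<ge> 2" if "f \<ge> 1"
  proof (rule ccontr)
    assume "\<not> ?thesis"
    then have "x f - 1 = 0" by simp
    then have "ord (finprod G (\<lambda>j. c (GenC f j)) {1..0}) = p ^ f"
      using \<phi> \<open>f \<ge> 1\<close> by (simp add: smooth_epimorphism_def c_eq)
    then have "p ^ f = 1" by (simp add: finprod_def)
    then show False using p \<open>f \<ge> 1\<close> by simp
  qed

  \<comment> \<open>The equality f' = f and the bound on \<open>f\<close>\<close>
  have "primed_index f x = f"
    using f' primed_index_eq_iff[of f x] by (cases "f = 0") (auto simp: primed_index_def)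
  moreover have "f \<le> e"
  proof (cases "f = 0")
    case False
    then have f1: "f \<in> {1..f}" "1 \<in> {1..x f}" using f' by auto
    \<comment> \<open>\<open>p^e\<close> annihilates every coordinate, hence also the generator
      \<open>c_f1\<close> of order \<open>p^f\<close>.\<close>
    have "int (p ^ fst t) dvd int (p ^ e) * y" if "t \<in> ?T" for t y
      using that by (intro dvd_mult2) (auto intro: le_imp_power_dvd)
    then have "ord (c (GenC f 1)) dvd p ^ e"
      by (simp only: ord_dvd_iff_coord[OF c_closed[OF C_in[OF f1]]]) blast
    then have "p ^ f dvd p ^ e" by (simp only: ord_c[OF f1])
    then show ?thesis using p by (simp add: power_dvd_imp_le)
  qed simp

  \<comment> \<open>Rank inequalities\<close>
  moreover have "1 + (\<Sum>j=i..e. r j) \<le> 2 * h + (\<Sum>j=i..f. x j)" if i: "i \<in> {1..f}" for i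
  proof -
    \<comment> \<open>This generator has index \<open>f \<ge> i\<close>, so it lies in
      \<open>?C\<close> for every \<open>i\<close>; dropping it accounts for the 1 in the
      inequality.\<close>
    let ?s = "GenC f (x f)" and ?C = "torsion_gens i f x"
    have s: "?s \<in> ?C" using i f' by (auto simp: torsion_gens_def)
    have C_sub: "?C \<subseteq> torsion_gens 1 f x" using i by (auto simp: torsion_gens_def)
    \<comment> \<open>At such \<open>t\<close> the long relation mod \<open>p\<close> involves only
      \<open>?C\<close>; solving for \<open>?s\<close> gives coefficient -1 on the rest of
      \<open>?C\<close> and 0 on the \<open>a_k\<close> and \<open>b_k\<close>.\<close>
    have s_redundant: "[\<chi> t (c ?s) =
        (\<Sum>s\<in>?AB \<union> ?C - {?s}. (if s \<in> ?C then - 1 else 0) * \<chi> t (c s))] (mod int p)"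
      if t: "t \<in> T' i" for t
    proof -
      have tT: "t \<in> ?T" "i \<le> fst t" using t T'_sub i by auto
      have "fst t > 0" using tT i by simp
      then have "int p dvd int (p ^ fst t)" by simp
      then have "int p dvd (\<Sum>s\<in>torsion_gens 1 f x. \<chi> t (c s))"
        using relation[OF tT(1)] by (meson cong_0_iff dvd_trans)
      \<comment> \<open>The generators outside \<open>?C\<close> have index below
        \<open>i \<le> fst t\<close>, so \<open>p\<close> divides each term.\<close>
      moreover have "int p dvd (\<Sum>s\<in>torsion_gens 1 f x - ?C. \<chi> t (c s))"
        using tT by (intro dvd_sum) (auto simp: torsion_gens_def intro!: p_dvd)
      ultimately have "int p dvd (\<Sum>s\<in>?C. \<chi> t (c s))"
        using sum.subset_diff[OF C_sub, of "\<lambda>s. \<chi> t (c s)"]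
        by (simp add: dvd_add_right_iff)
      moreover have "(\<Sum>s\<in>?AB \<union> ?C - {?s}. (if s \<in> ?C then - 1 else 0) * \<chi> t (c s)) =
          (\<Sum>s\<in>?C - {?s}. - \<chi> t (c s))"
        by (intro sum.mono_neutral_cong_right) auto
      ultimately show ?thesis
        using sum.remove[OF _ s, of "\<lambda>s. \<chi> t (c s)"]
        by (simp add: cong_iff_dvd_diff sum_negf)
    qed
    have "card (T' i) \<le> card (?AB \<union> ?C - {?s})"
    proof (rule card_le_if_spanning_mod_reduced[where a = "\<lambda>s t. \<chi> t (c s)", OF p])
      show "finite ?S" by (rule finite_gens)
      show "?AB \<union> ?C - {?s} \<subseteq> ?S" using C_sub by (auto simp: gens_eq_torsion_gens)
      show "finite (T' i)" by (simp add: T'_def)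
      show "\<exists>n. \<forall>t\<in>T' i. [v t = (\<Sum>s\<in>?S. n s * \<chi> t (c s))] (mod int p)" for v
        using T'_sub[of i] i by (intro span_p) auto
      fix s assume "s \<in> ?S - (?AB \<union> ?C - {?s})"
      then consider "s = ?s" | "s \<in> torsion_gens 1 f x - ?C"
        by (auto simp: gens_eq_torsion_gens)
      then show "\<exists>k. \<forall>t\<in>T' i. [\<chi> t (c s) = (\<Sum>s'\<in>?AB \<union> ?C - {?s}. k s' * \<chi> t (c s'))] (mod int p)"
      proof cases
        case 1
        show ?thesis unfolding 1
          by (intro exI[of _ "\<lambda>s. if s \<in> ?C then - 1 else 0"] ballI s_redundant)
      next
        case 2
        then show ?thesis using T'_sub[of i] i by (intro dropped) auto
      qed
    qed
    also have "\<dots> = card (?AB \<union> ?C) - 1" using s by simp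
    finally have "1 + card (T' i) \<le> card (?AB \<union> ?C)"
      using s card_gt_0_iff[of "?AB \<union> ?C"] by fastforce
    also have "\<dots> \<le> 2 * h + card ?C"
      using card_Un_le[of ?AB ?C] card_AB by linarith
    finally show ?thesis by (simp add: card_T' card_torsion_gens)
  qed
  moreover have "(\<Sum>j=f+1..e. r j) \<le> 2 * h"
  proof -
    \<comment> \<open>In summands of order above \<open>p^f\<close> all torsion generators vanish
      mod \<open>p\<close>, so the \<open>a_k\<close> and \<open>b_k\<close> alone span.\<close>
    have "card (T' (f + 1)) \<le> card ?AB"
    proof (rule card_le_if_spanning_mod_reduced[where a = "\<lambda>s t. \<chi> t (c s)", OF p])
      show "finite ?S" by (rule finite_gens)
      show "?AB \<subseteq> ?S" by (auto simp: gens_eq_torsion_gens)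
      show "finite (T' (f + 1))" by (simp add: T'_def)
      show "\<exists>n. \<forall>t\<in>T' (f + 1). [v t = (\<Sum>s\<in>?S. n s * \<chi> t (c s))] (mod int p)" for v
        using T'_sub[of "f + 1"] by (intro span_p) auto
      fix s assume "s \<in> ?S - ?AB"
      \<comment> \<open>The subtracted set is empty; it gives the claim the form that
        \<open>dropped\<close> expects.\<close>
      then have "s \<in> torsion_gens 1 f x - torsion_gens (f + 1) f x"
        by (auto simp: gens_eq_torsion_gens torsion_gens_def)
      then show "\<exists>k. \<forall>t\<in>T' (f + 1). [\<chi> t (c s) = (\<Sum>s'\<in>?AB. k s' * \<chi> t (c s'))] (mod int p)"
        using T'_sub[of "f + 1"] by (intro dropped) auto
    qed
    then show ?thesis using card_AB by (simp add: card_T')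
  qed

  \<comment> \<open>Parity of \<open>x f\<close> for \<open>p = 2\<close>\<close>
  moreover have "even (x f)" if p2: "p = 2" and less: "primed_index e r < f"
  proof -
    have f: "1 \<le> f" "f \<le> e" using less \<open>f \<le> e\<close> by auto
    \<comment> \<open>As \<open>r e \<ge> 1\<close> already exhausts the bound 1 on the tail sum,
      the summand of order \<open>2^e\<close> is the only one of order at least
      \<open>2^f\<close>.\<close>
    have "(\<Sum>k=f..e. r k) = r e + (\<Sum>k\<in>{f..e} - {e}. r k)"
      using f by (simp add: sum.remove)
    then have re: "r e = 1" and "(\<Sum>k\<in>{f..e} - {e}. r k) = 0"
      using sum_le_1_if_primed_index_less[OF less f(2)] assms(3) by linarith+
    then have rk: "r k = 0" if "f \<le> k" "k < e" for k using that by simp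
    define \<tau> where "\<tau> = (e, 1::nat)"
    have \<tau>: "\<tau> \<in> ?T" using assms(2) re by (simp add: \<tau>_def)
    have small: "fst t < f" if t: "t \<in> ?T" "t \<noteq> \<tau>" for t
    proof (rule ccontr)
      assume "\<not> ?thesis"
      then have "fst t = e" using t(1) rk[of "fst t"] by (cases t) force
      then show False using t re by (cases t) (auto simp: \<tau>_def)
    qed
    \<comment> \<open>The division is exact on torsion generators: their orders divide
      \<open>2^f\<close>, so \<open>2^(e-f)\<close> divides their coordinate at
      \<open>\<tau>\<close>.\<close>
    define u where "u s = \<chi> \<tau> (c s) div 2 ^ (e - f)" for s
    have dvd_iff: "2 ^ e dvd 2 ^ f * z \<longleftrightarrow> 2 ^ (e - f) dvd z" for z :: int
      using f dvd_mult_cancel_left[of "2 ^ f" "2 ^ (e - f)" z] by (simp flip: power_add)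
    have dvd_iff': "2 ^ e dvd 2 ^ (f - 1) * z \<longleftrightarrow> 2 * 2 ^ (e - f) dvd z" for z :: int
    proof -
      have "(2::int) ^ e = 2 ^ (f - 1) * (2 * 2 ^ (e - f))"
        using f power_add[of "2::int" "f - 1" "Suc (e - f)"] by simp
      then show ?thesis by (simp only: dvd_mult_cancel_left) simp
    qed
    have u: "\<chi> \<tau> (c (GenC i j)) = 2 ^ (e - f) * u (GenC i j)"
      if "i \<in> {1..f}" "j \<in> {1..x i}" for i j
      using annihilated[OF \<tau> that, of f] that
      by (simp add: u_def p2 \<tau>_def dvd_iff)
    \<comment> \<open>The order of \<open>c_ij\<close> divides \<open>2^(f-1)\<close> exactly for
      \<open>i < f\<close>; at \<open>\<tau>\<close> this divisibility says that \<open>u\<close> is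
      even.\<close>
    have parity: "even (u (GenC i j)) \<longleftrightarrow> i < f" if ij: "i \<in> {1..f}" "j \<in> {1..x i}" for i j
    proof
      assume "i < f"
      then have "2 * 2 ^ (e - f) dvd 2 ^ (e - f) * u (GenC i j)"
        using annihilated[OF \<tau> ij, of "f - 1"] dvd_iff' u[OF ij] by (simp add: p2 \<tau>_def)
      then show "even (u (GenC i j))" by (simp add: mult.commute)
    next
      assume even: "even (u (GenC i j))"
      show "i < f"
      proof (rule ccontr)
        assume "\<not> i < f"
        then have [simp]: "i = f" using ij by simp
        \<comment> \<open>Even \<open>u\<close> lets \<open>2^(f-1)\<close> kill the coordinate at
          \<open>\<tau>\<close>; it kills all others because their moduli divide
          \<open>2^(f-1)\<close>. The order would then be too small.\<close>
        have "int (2 ^ fst t) dvd int (2 ^ (f - 1)) * \<chi> t (c (GenC f j))" if t: "t \<in> ?T" for t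
        proof (cases "t = \<tau>")
          case True
          have "2 * 2 ^ (e - f) dvd 2 ^ (e - f) * u (GenC f j)"
            using even by (simp add: mult.commute)
          then have "2 ^ e dvd 2 ^ (f - 1) * \<chi> \<tau> (c (GenC f j))"
            using dvd_iff' u[OF ij] by simp
          then show ?thesis using True by (simp add: \<tau>_def)
        next
          case False
          then have "fst t \<le> f - 1" using small t by fastforce
          then show ?thesis by (intro dvd_mult2) (simp add: le_imp_power_dvd)
        qed
        then have "ord (c (GenC f j)) dvd 2 ^ (f - 1)"
          using ord_dvd_iff_coord[OF c_closed[OF C_in[OF ij]], of "2 ^ (f - 1)"]
          unfolding p2 \<open>i = f\<close> by blast
        then have "(2::nat) ^ f dvd 2 ^ (f - 1)" using ord_c[OF ij] p2 by simp
        then show False using f power_dvd_imp_le[of "2::nat" f "f - 1"] by simp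
      qed
    qed
    have "2 ^ e dvd (\<Sum>i=1..f. \<Sum>j=1..x i. 2 ^ (e - f) * u (GenC i j))"
      using relation[OF \<tau>] u by (simp add: sum_torsion_gens p2 \<tau>_def cong_0_iff)
    moreover have "(\<Sum>i=1..f. \<Sum>j=1..x i. 2 ^ (e - f) * u (GenC i j)) =
        2 ^ (e - f) * (\<Sum>i=1..f. \<Sum>j=1..x i. u (GenC i j))"
      by (simp add: sum_distrib_left)
    \<comment> \<open>As \<open>f \<ge> 1\<close>, the relation mod \<open>2^e\<close> can be
      weakened to modulus \<open>2^(e-f+1)\<close>; cancelling \<open>2^(e-f)\<close> leaves
      parity.\<close>
    moreover have "(2::int) * 2 ^ (e - f) dvd 2 ^ e"
      using f le_imp_power_dvd[of "Suc (e - f)" e "2::int"] by simp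
    ultimately have "2 * 2 ^ (e - f) dvd 2 ^ (e - f) * (\<Sum>i=1..f. \<Sum>j=1..x i. u (GenC i j))"
      by (metis (no_types) dvd_trans)
    then have "even (\<Sum>i=1..f. \<Sum>j=1..x i. u (GenC i j))" by (simp add: mult.commute)
    moreover have "(\<Sum>i=1..f. \<Sum>j=1..x i. u (GenC i j)) =
        (\<Sum>j=1..x f. u (GenC f j)) + (\<Sum>i\<in>{1..f} - {f}. \<Sum>j=1..x i. u (GenC i j))"
      using f by (intro sum.remove) auto
    moreover have "even (\<Sum>i\<in>{1..f} - {f}. \<Sum>j=1..x i. u (GenC i j))"
      by (intro dvd_sum) (auto simp: parity)
    ultimately have "even (\<Sum>j=1..x f. u (GenC f j))" by simp
    \<comment> \<open>A sum of integers is even exactly when it has an even number of odd terms, and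
      here all \<open>x f\<close> terms are odd.\<close>
    then have "even (card {j \<in> {1..x f}. odd (u (GenC f j))})"
      by (simp add: even_sum_iff)
    moreover have "{j \<in> {1..x f}. odd (u (GenC f j))} = {1..x f}"
      using f by (auto simp: parity)
    ultimately show ?thesis by simp
  qed
  ultimately show ?thesis by blast
qed

end
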